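(* For every integer $N \geq 1$ and every countable abelian group $G$, one has $H^2_{\mathsf{Bor}}(\mathbb{R}^N,G)=0$; that is, every Borel abelian cocycle $C\colon(\mathbb{R}^N)^2\to G$ is a Borel coboundary: there is a Borel map $h\colon\mathbb{R}^N\to G$ with $C(x,y)=h(x)+h(y)-h(x+y)$ for all $x,y\in\mathbb{R}^N$. Equivalently, the only Borel definable abelian group extension of $(\mathbb{R}^N,+)$ by $G$ is the trivial one.
   Context: $\mathbb{R}^N$ is the additive group with its usual Polish topology; $G$ carries the discrete topology. An abelian cocycle is a map $C\colon(\mathbb{R}^N)^2\to G$ with $C(x,0)=0$, $C(x,y)=C(y,x)$ and $C(x,y)+C(x+y,z)=C(x,z)+C(x+z,y)$ for all $x,y,z$. It is Borel if it is a Borel measurable map. A coboundary is a cocycle of the form $C_h(x,y)=h(x)+h(y)-h(x+y)$; a Borel coboundary is one with $h$ Borel. $H^2_{\mathsf{Bor}}(\mathbb{R}^N,G)$ is the group of Borel abelian cocycles modulo Borel coboundaries. An abelian extension of $\mathbb{R}^N$ by $G$ is Borel definable if it is induced by a Borel abelian cocycle. *)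

theory Defs
  imports "HOL-Analysis.Analysis" "HOL-Algebra.Elementary_Groups"
begin

definition abelian_cocycle :: "('a::ab_group_add \<times> 'a \<Rightarrow> 'g::ab_group_add) \<Rightarrow> bool" where
  "abelian_cocycle C \<longleftrightarrow>
     (\<forall>x. C (x, 0) = 0) \<and>
     (\<forall>x y. C (x, y) = C (y, x)) \<and>
     (\<forall>x y z. C (x, y) + C (x + y, z) = C (x, z) + C (x + z, y))"

definition coboundary_of :: "('a::ab_group_add \<Rightarrow> 'g::ab_group_add) \<Rightarrow> 'a \<times> 'a \<Rightarrow> 'g" where
  "coboundary_of h = (\<lambda>(x, y). h x + h y - h (x + y))"

text \<open>The coefficient group carries the discrete topology, whose Borel sets are all subsets;
  hence the target \<^term>\<open>count_space UNIV\<close>.\<close>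

definition borel_map :: "('b::topological_space \<Rightarrow> 'g) \<Rightarrow> bool" where
  "borel_map f \<longleftrightarrow> f \<in> measurable borel (count_space UNIV)"

definition borel_cocycles :: "('a::{topological_space, ab_group_add} \<times> 'a \<Rightarrow> 'g::ab_group_add) set" where
  "borel_cocycles = {C. abelian_cocycle C \<and> borel_map C}"

text \<open>A coboundary is required to be a cocycle, which amounts to \<^prop>\<open>h 0 = 0\<close>.\<close>

definition borel_coboundaries :: "('a::{topological_space, ab_group_add} \<times> 'a \<Rightarrow> 'g::ab_group_add) set" where
  "borel_coboundaries = {C. abelian_cocycle C \<and> (\<exists>h. borel_map h \<and> C = coboundary_of h)}"

definition borel_cocycle_group ::
    "('a::{topological_space, ab_group_add} \<times> 'a \<Rightarrow> 'g::ab_group_add) monoid" where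
  "borel_cocycle_group =
     \<lparr>carrier = borel_cocycles, mult = (\<lambda>C D u. C u + D u), one = (\<lambda>u. 0)\<rparr>"

definition H2_Bor :: "('a::{topological_space, ab_group_add} \<times> 'a \<Rightarrow> 'g::ab_group_add) set monoid" where
  "H2_Bor = borel_cocycle_group Mod borel_coboundaries"

text \<open>Short exact sequences \<open>0 \<rightarrow> G \<rightarrow> E \<rightarrow> A \<rightarrow> 0\<close> of abelian groups.\<close>

definition abelian_extension ::
    "('g::ab_group_add \<Rightarrow> 'e::ab_group_add) \<Rightarrow> ('e \<Rightarrow> 'a::ab_group_add) \<Rightarrow> bool" where
  "abelian_extension i p \<longleftrightarrow>
     Modules.additive i \<and> Modules.additive p \<and> inj i \<and> surj p \<and> range i = {e. p e = 0}"

text \<open>The addition on \<open>G \<times> A\<close> twisted by a cocycle. With the normalisation \<open>C (x, 0) = 0\<close>, the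
  resulting extension of \<open>A\<close> by \<open>G\<close> has inclusion \<open>g \<mapsto> (g, 0)\<close> and projection \<^const>\<open>snd\<close>.\<close>

definition cocycle_add ::
    "('a::ab_group_add \<times> 'a \<Rightarrow> 'g::ab_group_add) \<Rightarrow> 'g \<times> 'a \<Rightarrow> 'g \<times> 'a \<Rightarrow> 'g \<times> 'a" where
  "cocycle_add C = (\<lambda>(g, x) (k, y). (g + k + C (x, y), x + y))"

text \<open>An extension is induced by \<open>C\<close> if it is equivalent, as an extension, to the twisted product.\<close>

definition induced_by_cocycle ::
    "('a::ab_group_add \<times> 'a \<Rightarrow> 'g::ab_group_add) \<Rightarrow> ('g \<Rightarrow> 'e::ab_group_add) \<Rightarrow> ('e \<Rightarrow> 'a) \<Rightarrow> bool" where
  "induced_by_cocycle C i p \<longleftrightarrow>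
     (\<exists>\<phi> :: 'g \<times> 'a \<Rightarrow> 'e. bij \<phi> \<and>
        (\<forall>u v. \<phi> (cocycle_add C u v) = \<phi> u + \<phi> v) \<and>
        (\<forall>g. \<phi> (g, 0) = i g) \<and> (\<forall>u. p (\<phi> u) = snd u))"

definition borel_definable_extension ::
    "('g::ab_group_add \<Rightarrow> 'e::ab_group_add) \<Rightarrow> ('e \<Rightarrow> 'a::{topological_space, ab_group_add}) \<Rightarrow> bool" where
  "borel_definable_extension i p \<longleftrightarrow>
     abelian_extension i p \<and> (\<exists>C \<in> borel_cocycles. induced_by_cocycle C i p)"

text \<open>Equivalent, as an extension, to the direct sum (with the componentwise addition of pairs).\<close>

definition trivial_extension ::
    "('g::ab_group_add \<Rightarrow> 'e::ab_group_add) \<Rightarrow> ('e \<Rightarrow> 'a::ab_group_add) \<Rightarrow> bool" where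
  "trivial_extension i p \<longleftrightarrow>
     abelian_extension i p \<and>
     (\<exists>\<phi> :: 'g \<times> 'a \<Rightarrow> 'e. bij \<phi> \<and> Modules.additive \<phi> \<and>
        (\<forall>g. \<phi> (g, 0) = i g) \<and> (\<forall>u. p (\<phi> u) = snd u))"

end

theory Submission imports Defs begin

text \<open>The identity \<open>C (x, y) - C (x, y + z) = C (y, z) - C (x + y, z)\<close>, together with the
  continuity of translations in measure, shows that for small \<open>x\<close> the function \<open>C (x, \<cdot>)\<close> is
  constant on most of the unit ball. Its majority value \<open>s x\<close> satisfies
  \<open>C (x, y) = s x + s y - s (x + y)\<close> near the origin, so one may assume that \<open>C\<close> vanishes there.
  The unique divisibility of the domain then spreads this over the whole space: \<open>C\<close> is cohomologous to
  \<open>2\<^sup>n C (x/2\<^sup>n, y/2\<^sup>n)\<close>, which vanishes on a ball whose radius grows with \<open>n\<close>.\<close>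

section \<open>Continuity of translations in Lebesgue measure\<close>

lemma emeasure_lborel_translate:
  fixes A :: "'a::euclidean_space set"
  assumes "A \<in> sets borel"
  shows "emeasure lborel {u. x + u \<in> A} = emeasure lborel A"
proof -
  have "emeasure lborel A = emeasure (distr lborel borel ((+) x)) A"
    by (simp add: lborel_distr_plus)
  also have "\<dots> = emeasure lborel {u. x + u \<in> A}"
    using assms by (simp add: emeasure_distr vimage_def)
  finally show ?thesis ..
qed

text \<open>Regularity places \<open>S\<close> between a compact \<open>K\<close> and an open
  \<open>U\<close>, losing at most \<open>e/2\<close> on each side. Small translates of
  \<open>K\<close> stay in \<open>U\<close>, so a point of \<open>S\<close> that leaves
  \<open>S\<close> lies in \<open>S - K\<close> or lands in \<open>U - S\<close>.\<close>

lemma translate_almost_inside: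
  fixes S :: "'a::euclidean_space set"
  assumes S [measurable]: "S \<in> sets borel" and bS: "bounded S" and e: "0 < e"
  obtains d where "d > 0"
    "\<And>x. norm x < d \<Longrightarrow> emeasure lborel {u \<in> S. x + u \<notin> S} \<le> ennreal e"
proof -
  obtain U where U: "open U" "S \<subseteq> U" "emeasure lborel (U - S) < ennreal (e/2)"
    using outer_regular_lborel[OF S, of "e/2"] e by auto
  \<comment> \<open>Inner approximation comes from outer regularity of the complement; boundedness
    of \<open>S\<close> makes the closed set \<open>- W\<close> compact.\<close>
  have "- S \<in> sets borel" by auto
  then obtain W where W: "open W" "- S \<subseteq> W" "emeasure lborel (W - - S) < ennreal (e/2)"
    using outer_regular_lborel[of "- S" "e/2"] e by auto
  define K where "K = - W"
  have KS: "K \<subseteq> S" using W by (auto simp: K_def)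
  have "compact K"
    unfolding compact_eq_bounded_closed using W bounded_subset[OF bS KS]
    by (auto simp: K_def)
  then obtain d where d: "d > 0" "(\<Union>x\<in>K. ball x d) \<subseteq> U"
    using compact_subset_open_imp_ball_epsilon_subset[of K U] U KS by blast
  have [measurable]: "K \<in> sets borel" "U \<in> sets borel" "W \<in> sets borel"
    using U W by (auto simp: K_def)
  have SK: "S - K = W - - S" by (auto simp: K_def)
  show ?thesis
  proof
    fix x :: 'a assume x: "norm x < d"
    have "x + u \<in> U" if "u \<in> K" for u
    proof -
      have "x + u \<in> ball u d" using x by (simp add: dist_norm)
      then show ?thesis using d that by blast
    qed
    then have "{u \<in> S. x + u \<notin> S} \<subseteq> (S - K) \<union> {u. x + u \<in> U - S}" by auto
    then have "emeasure lborel {u \<in> S. x + u \<notin> S} \<le> emeasure lborel ((S - K) \<union> {u. x + u \<in> U - S})"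
      by (intro emeasure_mono) measurable
    also have "\<dots> \<le> emeasure lborel (S - K) + emeasure lborel {u. x + u \<in> U - S}"
      by (intro emeasure_subadditive) measurable
    also have "\<dots> = emeasure lborel (W - - S) + emeasure lborel (U - S)"
      using emeasure_lborel_translate[of "U - S" x] SK by simp
    also have "\<dots> \<le> ennreal (e/2) + ennreal (e/2)"
      using U W by (intro add_mono) auto
    also have "\<dots> = ennreal e" using e by (subst ennreal_plus [symmetric]) auto
    finally show "emeasure lborel {u \<in> S. x + u \<notin> S} \<le> ennreal e" .
  qed (use d in auto)
qed

text \<open>Since the target is countable, all but finitely many values of \<open>F\<close> occupy
  only a small part of \<open>S\<close>. Each of the remaining level sets is nearly invariant under
  small translations.\<close>

lemma translate_almost_invariant:
  fixes F :: "'a::euclidean_space \<Rightarrow> 'c::countable"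
  assumes F [measurable]: "F \<in> measurable borel (count_space UNIV)"
    and S [measurable]: "S \<in> sets borel" and bS: "bounded S" and e: "0 < e"
  obtains d where "d > 0"
    "\<And>x. norm x < d \<Longrightarrow> emeasure lborel {u \<in> S. F (x + u) \<noteq> F u} \<le> ennreal e"
proof -
  define T where "T n = {u \<in> S. n \<le> to_nat (F u)}" for n
  define L where "L j = {u \<in> S. to_nat (F u) = j}" for j
  have [measurable]: "T n \<in> sets borel" "L n \<in> sets borel" for n
    unfolding T_def L_def by measurable
  have "(\<lambda>n. emeasure lborel (T n)) \<longlonglongrightarrow> emeasure lborel (\<Inter>n. T n)"
  proof (rule Lim_emeasure_decseq)
    show "emeasure lborel (T n) \<noteq> \<infinity>" for n
      using emeasure_bounded_finite[of "T n"] bounded_subset[OF bS, of "T n"]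
      by (auto simp: T_def)
  qed (auto simp: T_def decseq_def)
  moreover have "(\<Inter>n. T n) = {}"
  proof (intro equals0I)
    fix u assume "u \<in> (\<Inter>n. T n)"
    then have "u \<in> T (Suc (to_nat (F u)))" by blast
    then show False by (simp add: T_def)
  qed
  ultimately have "(\<lambda>n. emeasure lborel (T n)) \<longlonglongrightarrow> 0" by simp
  then have "eventually (\<lambda>n. emeasure lborel (T n) < ennreal (e/2)) sequentially"
    by (rule order_tendstoD) (use e in auto)
  then obtain n where n: "emeasure lborel (T n) < ennreal (e/2)"
    by (auto simp: eventually_sequentially)
  \<comment> \<open>The \<open>n\<close> level sets together may cost \<open>e/2\<close>;
    \<open>Suc n\<close> keeps the denominator positive when \<open>n = 0\<close>.\<close>
  define c where "c = e / (2 * real (Suc n))"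
  have c: "c > 0" using e by (simp add: c_def)
  have "\<exists>d>0. \<forall>x. norm x < d \<longrightarrow> emeasure lborel {u \<in> L j. x + u \<notin> L j} \<le> ennreal c" for j
  proof -
    have "L j \<in> sets borel" "bounded (L j)"
      using bounded_subset[OF bS, of "L j"] by (auto simp: L_def)
    from translate_almost_inside[OF this c] show ?thesis by blast
  qed
  then have "\<forall>j. \<exists>d. d > 0 \<and> (\<forall>x. norm x < d \<longrightarrow> emeasure lborel {u \<in> L j. x + u \<notin> L j} \<le> ennreal c)"
    by blast
  from choice[OF this] obtain d where d: "\<And>j. d j > 0"
    "\<And>j x. norm x < d j \<Longrightarrow> emeasure lborel {u \<in> L j. x + u \<notin> L j} \<le> ennreal c"
    by blast
  \<comment> \<open>Only indices below \<open>n\<close> matter; including \<open>n\<close> keeps the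
    set nonempty for \<open>Min\<close>.\<close>
  define r where "r = Min (d ` {..n})"
  show ?thesis
  proof
    show "r > 0" using d by (simp add: r_def)
    fix x :: 'a assume "norm x < r"
    then have x: "norm x < d j" if "j < n" for j
      using that by (simp add: r_def)
    have "{u \<in> S. F (x + u) \<noteq> F u} \<subseteq> T n \<union> (\<Union>j\<in>{..<n}. {u \<in> L j. x + u \<notin> L j})"
      by (auto simp: T_def L_def)
    then have "emeasure lborel {u \<in> S. F (x + u) \<noteq> F u}
        \<le> emeasure lborel (T n \<union> (\<Union>j\<in>{..<n}. {u \<in> L j. x + u \<notin> L j}))"
      by (intro emeasure_mono) measurable
    also have "\<dots> \<le> emeasure lborel (T n) + emeasure lborel (\<Union>j\<in>{..<n}. {u \<in> L j. x + u \<notin> L j})"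
      by (intro emeasure_subadditive) measurable
    also have "\<dots> \<le> ennreal (e/2) + (\<Sum>j<n. emeasure lborel {u \<in> L j. x + u \<notin> L j})"
      using n by (intro add_mono emeasure_subadditive_finite) (auto simp: image_subset_iff)
    also have "\<dots> \<le> ennreal (e/2) + (\<Sum>j<n. ennreal c)"
      by (intro add_mono sum_mono) (auto intro!: d x)
    also have "\<dots> = ennreal (e/2 + real n * c)"
      using e c by (simp add: ennreal_of_nat_eq_real_of_nat ennreal_mult ennreal_plus)
    also have "\<dots> \<le> ennreal e"
      using e by (intro ennreal_leI) (simp add: c_def field_simps)
    finally show "emeasure lborel {u \<in> S. F (x + u) \<noteq> F u} \<le> ennreal e" .
  qed
qed

section \<open>Measurability of maps into countable discrete groups and of sections\<close>

lemma borel_map_binop: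
  fixes f :: "'a::topological_space \<Rightarrow> 'b::countable" and g :: "'a \<Rightarrow> 'c::countable"
  assumes "borel_map f" and "borel_map g"
  shows "borel_map (\<lambda>x. F (f x) (g x))"
proof -
  have [measurable]: "f \<in> measurable borel (count_space UNIV)" "g \<in> measurable borel (count_space UNIV)"
    using assms by (auto simp: borel_map_def)
  show ?thesis unfolding borel_map_def by measurable
qed

lemma borel_map_compose:
  "borel_map f \<Longrightarrow> g \<in> borel_measurable borel \<Longrightarrow> borel_map (\<lambda>x. f (g x))"
  unfolding borel_map_def by (rule measurable_compose)

lemma borel_vertical_section:
  fixes A :: "('a::second_countable_topology \<times> 'b::second_countable_topology) set"
  assumes "A \<in> sets borel"
  shows "Pair x -` A \<in> sets borel"
proof -
  have "A \<in> sets (borel \<Otimes>\<^sub>M borel)" unfolding borel_prod by (fact assms)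
  then show ?thesis by (rule sets_Pair1)
qed

lemma borel_measurable_emeasure_section:
  fixes A :: "('a::euclidean_space \<times> 'b::euclidean_space) set"
  assumes "A \<in> sets borel"
  shows "(\<lambda>x. emeasure lborel (Pair x -` A)) \<in> borel_measurable borel"
proof (rule lborel.measurable_emeasure_Pair)
  have "sets (borel \<Otimes>\<^sub>M lborel :: ('a \<times> 'b) measure) = sets (borel \<Otimes>\<^sub>M borel)"
    by (intro sets_pair_measure_cong) auto
  then show "A \<in> sets (borel \<Otimes>\<^sub>M lborel)" using assms unfolding borel_prod by simp
qed

section \<open>Borel cocycles are coboundaries near the origin\<close>

text \<open>Symmetry turns the permuted identity in \<open>abelian_cocycle\<close> into
  associativity of the twisted addition.\<close>

lemma cocycle_assoc:
  assumes "abelian_cocycle C"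
  shows "C (x, y) + C (x + y, z) = C (y, z) + C (x, y + z)"
  using assms unfolding abelian_cocycle_def by (metis add.commute)

text \<open>An averaging argument: if every value were missed on measure at least \<open>e\<close>,
  then so would be \<open>C (x, y)\<close> for each \<open>y\<close> in the unit ball. By Fubini,
  translation by \<open>(x, 0)\<close> would then change \<open>C\<close> on too large a subset of
  the product.\<close>

lemma cocycle_mostly_constant:
  fixes C :: "'a::euclidean_space \<times> 'a \<Rightarrow> 'g::{ab_group_add, countable}"
  assumes C: "abelian_cocycle C" and borel: "borel_map C" and e: "0 < e"
  obtains d where "d > 0"
    "\<And>x. norm x < d \<Longrightarrow> \<exists>g. emeasure lborel {w \<in> cball 0 1. C (x, w) \<noteq> g} < ennreal e"
proof -
  have [measurable]: "C \<in> measurable borel (count_space UNIV)"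
    using borel by (simp add: borel_map_def)
  define B :: "'a set" where "B = cball 0 1"
  define V where "V = measure lborel B"
  have V: "V > 0" "emeasure lborel B = ennreal V"
    using content_cball_pos[of 1 "0::'a"] emeasure_eq_ennreal_measure[of lborel B] emeasure_bounded_finite[of B]
    by (auto simp: V_def B_def)
  \<comment> \<open>Radius 2 leaves room for \<open>w - y\<close> with \<open>w\<close> and
    \<open>y\<close> in the unit ball.\<close>
  define S :: "('a \<times> 'a) set" where "S = B \<times> cball 0 2"
  have S [measurable]: "S \<in> sets borel" and "bounded S"
    by (auto simp: S_def B_def bounded_Times closed_Times intro!: borel_closed)
  obtain d where d: "d > 0" "\<And>x. norm x < d \<Longrightarrow>
      emeasure lborel {u \<in> S. C (x + u) \<noteq> C u} \<le> ennreal (e * V / 2)"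
    using translate_almost_invariant[of C S "e * V / 2"] \<open>bounded S\<close> e V by auto
  show ?thesis
  proof
    fix x :: 'a assume x: "norm x < d"
    define N where "N = {u \<in> S. C ((x, 0) + u) \<noteq> C u}"
    have [measurable]: "N \<in> sets borel" unfolding N_def by measurable
    show "\<exists>g. emeasure lborel {w \<in> cball 0 1. C (x, w) \<noteq> g} < ennreal e"
    proof (rule ccontr)
      assume "\<not> ?thesis"
      then have large: "ennreal e \<le> emeasure lborel {w \<in> B. C (x, w) \<noteq> g}" for g
        by (auto simp: not_less B_def)
      have "ennreal e * indicator B y \<le> emeasure lborel (Pair y -` N)" for y
      proof (cases "y \<in> B")
        case True
        have "(y, w - y) \<in> N" if w: "w \<in> B" "C (x, w) \<noteq> C (x, y)" for w
        proof -
          have "norm (w - y) \<le> norm w + norm y" by (rule norm_triangle_ineq4)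
          then have "(y, w - y) \<in> S" using w True by (auto simp: S_def B_def)
          \<comment> \<open>By the cocycle identity the two sides differ by
            \<open>C (x, w) - C (x, y)\<close>.\<close>
          moreover have "C (x + y, w - y) \<noteq> C (y, w - y)"
            using cocycle_assoc[OF C, of x y "w - y"] w by auto
          ultimately show ?thesis by (simp add: N_def)
        qed
        then have sub: "{w \<in> B. C (x, w) \<noteq> C (x, y)} \<subseteq> {w. - y + w \<in> Pair y -` N}" by auto
        have [measurable]: "Pair y -` N \<in> sets borel"
          by (rule borel_vertical_section) measurable
        have "ennreal e \<le> emeasure lborel {w \<in> B. C (x, w) \<noteq> C (x, y)}" by (rule large)
        also have "\<dots> \<le> emeasure lborel {w. - y + w \<in> Pair y -` N}"
          by (rule emeasure_mono[OF sub]) measurable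
        also have "\<dots> = emeasure lborel (Pair y -` N)"
          by (rule emeasure_lborel_translate) measurable
        finally show ?thesis using True by simp
      qed auto
      then have "(\<integral>\<^sup>+y. ennreal e * indicator B y \<partial>lborel) \<le> (\<integral>\<^sup>+y. emeasure lborel (Pair y -` N) \<partial>lborel)"
        by (intro nn_integral_mono)
      also have "\<dots> = emeasure (lborel \<Otimes>\<^sub>M lborel) N"
        by (rule lborel.emeasure_pair_measure_alt [symmetric]) (unfold lborel_prod sets_lborel, measurable)
      also have "\<dots> = emeasure lborel N" by (simp add: lborel_prod)
      also have "\<dots> \<le> ennreal (e * V / 2)"
        using d(2)[of "(x, 0)"] x by (simp add: N_def norm_Pair)
      finally have "ennreal (e * V) \<le> ennreal (e * V / 2)"
        using e V by (simp add: nn_integral_cmult_indicator B_def ennreal_mult)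
      then show False using e V by (simp add: ennreal_le_iff)
    qed
  qed (rule d)
qed

text \<open>A strict union bound, used to find a point at which several majority statements hold at
  once.\<close>

lemma four_quarters_miss_point:
  assumes "A1 \<in> sets M" "A2 \<in> sets M" "A3 \<in> sets M" "A4 \<in> sets M"
    and "emeasure M A1 < ennreal (v/4)" "emeasure M A2 < ennreal (v/4)"
    and "emeasure M A3 < ennreal (v/4)" "emeasure M A4 < ennreal (v/4)"
    and v: "emeasure M B = ennreal v"
  obtains z where "z \<in> B" "z \<notin> A1" "z \<notin> A2" "z \<notin> A3" "z \<notin> A4"
proof -
  have "v > 0" using assms(5) by (cases "v > 0") (auto simp: ennreal_neg)
  have "emeasure M (A1 \<union> A2 \<union> (A3 \<union> A4)) \<le> emeasure M (A1 \<union> A2) + emeasure M (A3 \<union> A4)"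
    using assms by (intro emeasure_subadditive) auto
  also have "\<dots> \<le> (emeasure M A1 + emeasure M A2) + (emeasure M A3 + emeasure M A4)"
    using assms by (intro add_mono emeasure_subadditive) auto
  also have "\<dots> < (ennreal (v/4) + ennreal (v/4)) + (ennreal (v/4) + ennreal (v/4))"
    using assms by (intro add_strict_mono)
  also have "\<dots> = emeasure M B"
    using \<open>v > 0\<close> v by (simp flip: ennreal_plus)
  finally have "\<not> B \<subseteq> A1 \<union> A2 \<union> (A3 \<union> A4)"
    using assms emeasure_mono[of B "A1 \<union> A2 \<union> (A3 \<union> A4)" M] by (auto simp: not_le[symmetric])
  then show ?thesis using that by blast
qed

text \<open>Choose \<open>z\<close> at which \<open>C (x + y, z)\<close>, \<open>C (y, z)\<close>
  and \<open>C (x, y + z)\<close> all equal their majority values; the cocycle identity for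
  \<open>x\<close>, \<open>y\<close>, \<open>z\<close> is then the claim.\<close>

lemma borel_cocycle_locally_coboundary:
  fixes C :: "'a::euclidean_space \<times> 'a \<Rightarrow> 'g::{ab_group_add, countable}"
  assumes C: "abelian_cocycle C" and borel: "borel_map C"
  obtains s d where "borel_map s" "d > 0"
    "\<And>x y. norm x < d \<Longrightarrow> norm y < d \<Longrightarrow> norm (x + y) < d \<Longrightarrow> C (x, y) = s x + s y - s (x + y)"
proof -
  have [measurable]: "C \<in> measurable borel (count_space UNIV)"
    using borel by (simp add: borel_map_def)
  define B :: "'a set" where "B = cball 0 1"
  have [measurable]: "B \<in> sets borel" and bB: "bounded B" by (auto simp: B_def)
  define V where "V = measure lborel B"
  have V: "V > 0" "emeasure lborel B = ennreal V"
    using content_cball_pos[of 1 "0::'a"] emeasure_eq_ennreal_measure[of lborel B] emeasure_bounded_finite[of B]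
    by (auto simp: V_def B_def)
  have [measurable]: "snd \<in> borel_measurable (borel :: ('a \<times> 'a) measure)"
    by (intro borel_measurable_continuous_onI continuous_intros)
  define bad where "bad x g = {w \<in> B. C (x, w) \<noteq> g}" for x g
  have bad [measurable]: "bad x g \<in> sets borel" for x g
  proof -
    have "Pair x -` {u. snd u \<in> B \<and> C u \<noteq> g} \<in> sets borel"
      by (rule borel_vertical_section) measurable
    then show ?thesis by (simp add: bad_def vimage_def)
  qed
  \<comment> \<open>Below one half would already make \<open>g\<close> unique; one quarter allows
    four exceptional sets in the choice of \<open>z\<close>.\<close>
  define P where "P x g \<longleftrightarrow> emeasure lborel (bad x g) < ennreal (V/4)" for x g
  have uniq: "g = g'" if P: "P x g" "P x g'" for x g g'
  proof -
    obtain z where "z \<in> B" "z \<notin> bad x g" "z \<notin> bad x g'"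
      using four_quarters_miss_point[of "bad x g" lborel "bad x g'" "{}" "{}" V B] P V bad
      by (auto simp: P_def)
    then show ?thesis by (simp add: bad_def)
  qed
  have [measurable]: "{x. P x g} \<in> sets borel" for g
  proof -
    have "(\<lambda>x. emeasure lborel (Pair x -` {u. snd u \<in> B \<and> C u \<noteq> g})) \<in> borel_measurable borel"
      by (rule borel_measurable_emeasure_section) measurable
    then have [measurable]: "(\<lambda>x. emeasure lborel (bad x g)) \<in> borel_measurable borel"
      by (simp add: bad_def vimage_def)
    show ?thesis unfolding P_def by measurable
  qed
  \<comment> \<open>The default 0, taken where no majority value exists, keeps every level set of
    \<open>s\<close> Borel.\<close>
  define s where "s x = (if \<exists>g. P x g then THE g. P x g else 0)" for x
  have sP: "s x = g" if "P x g" for x g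
    using that uniq by (auto simp: s_def)
  have "s x = g \<longleftrightarrow> P x g \<or> (g = 0 \<and> (\<forall>k. \<not> P x k))" for x g
  proof (cases "\<exists>k. P x k")
    case True
    then show ?thesis using sP by blast
  next
    case False
    then show ?thesis by (auto simp: s_def)
  qed
  then have "s -` {g} = {x. P x g} \<union> (if g = 0 then - (\<Union>k. {x. P x k}) else {})" for g
    by auto
  then have s: "borel_map s"
    unfolding borel_map_def by (auto simp: measurable_count_space_eq2_countable)
  obtain d1 where d1: "d1 > 0" "\<And>x. norm x < d1 \<Longrightarrow> \<exists>g. P x g"
    using cocycle_mostly_constant[OF C borel, of "V/4"] V by (auto simp: P_def bad_def B_def)
  \<comment> \<open>The bound obtained is not strict, so \<open>V/5\<close> is requested to stay
    strictly below \<open>V/4\<close>.\<close>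
  obtain d2 where d2: "d2 > 0"
    "\<And>y. norm y < d2 \<Longrightarrow> emeasure lborel {w \<in> B. y + w \<notin> B} \<le> ennreal (V/5)"
    using translate_almost_inside[of B "V/5"] V bB by auto
  have Ps: "P x (s x)" if "norm x < d1" for x
    using d1(2)[OF that] sP by blast
  show ?thesis
  proof
    show "min d1 d2 > 0" using d1 d2 by simp
    fix x y :: 'a
    assume xy: "norm x < min d1 d2" "norm y < min d1 d2" "norm (x + y) < min d1 d2"
    have "emeasure lborel {w \<in> B. y + w \<notin> B} < ennreal (V/4)"
      using d2(2)[of y] xy V by (auto intro: le_less_trans simp: ennreal_less_iff)
    moreover have "emeasure lborel {w. y + w \<in> bad x (s x)} < ennreal (V/4)"
      using Ps[of x] xy emeasure_lborel_translate[OF bad, of y x "s x"] by (simp add: P_def)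
    \<comment> \<open>Avoiding the third set puts \<open>y + z\<close> in \<open>B\<close>; only
      then does avoiding the fourth give \<open>C (x, y + z) = s x\<close>.\<close>
    ultimately obtain z where z: "z \<in> B" "z \<notin> bad (x + y) (s (x + y))" "z \<notin> bad y (s y)"
        "z \<notin> {w \<in> B. y + w \<notin> B}" "z \<notin> {w. y + w \<in> bad x (s x)}"
      using four_quarters_miss_point[of "bad (x + y) (s (x + y))" lborel "bad y (s y)"
          "{w \<in> B. y + w \<notin> B}" "{w. y + w \<in> bad x (s x)}" V B] Ps[of y] Ps[of "x + y"] xy V bad
      by (auto simp: P_def)
    then have "C (x + y, z) = s (x + y)" "C (y, z) = s y" "C (x, y + z) = s x"
      by (auto simp: bad_def)
    then show "C (x, y) = s x + s y - s (x + y)"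
      using cocycle_assoc[OF C, of x y z] by (simp add: algebra_simps)
  qed (rule s)
qed

section \<open>From local to global by halving\<close>

definition doubling :: "('a::real_vector \<times> 'a \<Rightarrow> 'g::ab_group_add) \<Rightarrow> 'a \<times> 'a \<Rightarrow> 'g" where
  "doubling C = (\<lambda>(x, y). C (x /\<^sub>R 2, y /\<^sub>R 2) + C (x /\<^sub>R 2, y /\<^sub>R 2))"

lemma abelian_cocycle_add:
  assumes "abelian_cocycle C" "abelian_cocycle D"
  shows "abelian_cocycle (\<lambda>u. C u + D u)"
proof -
  have "C (x, y) + D (x, y) + (C (x + y, z) + D (x + y, z)) =
        C (x, z) + D (x, z) + (C (x + z, y) + D (x + z, y))" for x y z
  proof -
    have "C (x, y) + D (x, y) + (C (x + y, z) + D (x + y, z)) =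
        (C (x, y) + C (x + y, z)) + (D (x, y) + D (x + y, z))" by (simp add: algebra_simps)
    also have "\<dots> = (C (x, z) + C (x + z, y)) + (D (x, z) + D (x + z, y))"
      using assms unfolding abelian_cocycle_def by metis
    finally show ?thesis by (simp add: algebra_simps)
  qed
  then show ?thesis using assms by (simp add: abelian_cocycle_def)
qed

lemma abelian_cocycle_uminus:
  "abelian_cocycle C \<Longrightarrow> abelian_cocycle (\<lambda>u. - C u)"
  unfolding abelian_cocycle_def by (metis minus_add_distrib minus_zero)

lemma abelian_cocycle_zero: "abelian_cocycle (\<lambda>u. 0)"
  by (simp add: abelian_cocycle_def)

lemma abelian_cocycle_coboundary_of: "h 0 = 0 \<Longrightarrow> abelian_cocycle (coboundary_of h)"
  by (simp add: abelian_cocycle_def coboundary_of_def algebra_simps)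

lemma abelian_cocycle_compose:
  assumes "abelian_cocycle C" "f 0 = 0" "\<And>x y. f (x + y) = f x + f y"
  shows "abelian_cocycle (\<lambda>(x, y). C (f x, f y))"
  using assms(1) unfolding abelian_cocycle_def split_conv assms(2,3) by blast

lemma abelian_cocycle_doubling:
  assumes "abelian_cocycle C"
  shows "abelian_cocycle (doubling C)"
proof -
  have "abelian_cocycle (\<lambda>(x, y). C (x /\<^sub>R 2, y /\<^sub>R 2))"
    using assms by (rule abelian_cocycle_compose) (simp_all add: scaleR_add_right)
  from abelian_cocycle_add[OF this this] show ?thesis
    by (simp add: doubling_def case_prod_beta')
qed

lemma borel_map_coboundary_of:
  fixes h :: "'a::euclidean_space \<Rightarrow> 'g::{ab_group_add, countable}"
  assumes "borel_map h"
  shows "borel_map (coboundary_of h)"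
proof -
  have 1: "borel_map (\<lambda>u :: 'a \<times> 'a. h (fst u))" and 2: "borel_map (\<lambda>u :: 'a \<times> 'a. h (snd u))"
    and 3: "borel_map (\<lambda>u :: 'a \<times> 'a. h (fst u + snd u))"
    by (rule borel_map_compose[OF assms], intro borel_measurable_continuous_onI continuous_intros)+
  from borel_map_binop[OF borel_map_binop[OF 1 2, of "(+)"] 3, of "(-)"]
  show ?thesis by (simp add: coboundary_of_def case_prod_beta')
qed

text \<open>In the extension defined by \<open>C\<close>, twice the element \<open>(0, x/2)\<close> is \<open>(C (x/2, x/2), x)\<close>;
  \<^const>\<open>doubling\<close> is the cocycle of this section.\<close>

lemma doubling_eq:
  assumes C: "abelian_cocycle C"
  shows "doubling C (x, y) = C (x, y) + C (x /\<^sub>R 2, x /\<^sub>R 2) + C (y /\<^sub>R 2, y /\<^sub>R 2)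
    - C ((x + y) /\<^sub>R 2, (x + y) /\<^sub>R 2)"
proof -
  define u v where "u = x /\<^sub>R 2" and "v = y /\<^sub>R 2"
  have xy: "x = u + u" "y = v + v" "(x + y) /\<^sub>R 2 = u + v"
    by (simp_all add: u_def v_def scaleR_add_right flip: scaleR_2)
  \<comment> \<open>These three instances regroup the twisted sum of \<open>u\<close>,
    \<open>u\<close>, \<open>v\<close>, \<open>v\<close> from \<open>(u + u) + (v + v)\<close> to
    \<open>(u + v) + (u + v)\<close>.\<close>
  have 1: "C (u, u) + C (u + u, v + v) = C (u, v + v) + C (u, u + (v + v))"
    by (rule cocycle_assoc[OF C])
  have 2: "C (v, v) + C (v + v, u) = C (v, u) + C (v, v + u)"
    by (rule cocycle_assoc[OF C])
  have 3: "C (u, v) + C (u + v, u + v) = C (v, u + v) + C (u, v + (u + v))"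
    by (rule cocycle_assoc[OF C])
  have sym: "C (a, b) = C (b, a)" for a b
    using C by (simp add: abelian_cocycle_def)
  have "C (u, u) + C (x, y) + C (v, v) = C (u, v) + C (u, v) + C (u + v, u + v)"
    using 1 2 3 sym[of v u] sym[of "v + v" u] by (simp add: xy algebra_simps)
  then show ?thesis
    unfolding doubling_def split_conv xy(3) u_def[symmetric] v_def[symmetric]
    by (simp add: algebra_simps)
qed

lemma borel_map_doubling:
  fixes C :: "'a::euclidean_space \<times> 'a \<Rightarrow> 'g::{ab_group_add, countable}"
  assumes "borel_map C"
  shows "borel_map (doubling C)"
proof -
  have "borel_map (\<lambda>u. C (fst u /\<^sub>R 2, snd u /\<^sub>R 2))"
    by (rule borel_map_compose[OF assms])
      (intro borel_measurable_continuous_onI continuous_intros)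
  from borel_map_binop[OF this this, of "(+)"] show ?thesis
    by (simp add: doubling_def case_prod_beta')
qed

text \<open>Iterated \<^const>\<open>doubling\<close> spreads local vanishing over the whole space, and only finitely
  many of the corrections collected on the way are nonzero at any given point.\<close>

lemma locally_zero_cocycle_coboundary:
  fixes D :: "'a::euclidean_space \<times> 'a \<Rightarrow> 'g::{ab_group_add, countable}"
  assumes D: "abelian_cocycle D" "borel_map D" and d: "d > 0"
    and zero: "\<And>x y. norm x < d \<Longrightarrow> norm y < d \<Longrightarrow> norm (x + y) < d \<Longrightarrow> D (x, y) = 0"
  obtains h where "borel_map h" "\<And>x y. D (x, y) = h x + h y - h (x + y)"
proof -
  define E where "E n = (doubling ^^ n) D" for n
  have E_Suc: "E (Suc n) = doubling (E n)" for n by (simp add: E_def)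
  have E: "abelian_cocycle (E n) \<and> borel_map (E n)" for n
    by (induction n) (simp_all add: E_Suc abelian_cocycle_doubling borel_map_doubling D, simp_all add: E_def D)
  have E_zero: "E n (x, y) = 0" if "norm x < 2^n * d" "norm y < 2^n * d" "norm (x + y) < 2^n * d" for n x y
    using that
  proof (induction n arbitrary: x y)
    case 0
    then show ?case by (simp add: E_def zero)
  next
    case (Suc n)
    have "E n (x /\<^sub>R 2, y /\<^sub>R 2) = 0"
      by (rule Suc.IH) (use Suc.prems in \<open>simp_all flip: scaleR_add_right\<close>)
    then show ?case by (simp add: E_Suc doubling_def)
  qed
  \<comment> \<open>By \<open>doubling_eq\<close>, \<open>E (Suc n)\<close> is \<open>E n\<close>
    plus the coboundary of \<open>t n\<close>.\<close>
  define t where "t n x = E n (x /\<^sub>R 2, x /\<^sub>R 2)" for n x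
  have t: "borel_map (t n)" for n
    unfolding t_def by (rule borel_map_compose) (use E in auto)
  have t_zero: "t n x = 0" if "norm x < 2^n * d" for n x
  proof -
    have "x /\<^sub>R 2 + x /\<^sub>R 2 = x" by (simp flip: scaleR_add_left)
    moreover have "norm (x /\<^sub>R 2) < 2^n * d"
      by (rule le_less_trans[OF _ that]) simp
    ultimately show ?thesis unfolding t_def using that by (intro E_zero) (simp_all only:)
  qed
  define H where "H n x = (\<Sum>k<n. t k x)" for n x
  have H: "borel_map (H n)" for n
  proof (induction n)
    case 0
    show ?case by (simp add: H_def borel_map_def)
  next
    case (Suc n)
    from borel_map_binop[OF Suc.IH t, of "(+)" n] show ?case by (simp add: H_def)
  qed
  have E_eq: "E n (x, y) = D (x, y) + H n x + H n y - H n (x + y)" for n x y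
  proof (induction n)
    case 0
    show ?case by (simp add: E_def H_def)
  next
    case (Suc n)
    have "E (Suc n) (x, y) = E n (x, y) + t n x + t n y - t n (x + y)"
      unfolding E_Suc t_def using E by (intro doubling_eq) auto
    then show ?case by (simp add: Suc.IH) (simp add: H_def algebra_simps)
  qed
  \<comment> \<open>A Borel stopping index: from \<open>K x\<close> on, all corrections at
    \<open>x\<close> vanish. No logarithm is taken because \<open>n < 2^n\<close> suffices.\<close>
  define K where "K x = nat \<lceil>norm x / d\<rceil>" for x :: 'a
  have K: "norm x < 2^n * d" if "K x \<le> n" for n x
  proof -
    have "norm x / d \<le> real n" using that by (simp add: K_def nat_le_iff ceiling_le_iff)
    also have "\<dots> < 2^n" using of_nat_less_two_power by blast
    finally show ?thesis using d by (simp add: field_simps)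
  qed
  \<comment> \<open>The sign arises because \<open>D\<close> plus the coboundary of
    \<open>H n\<close> is \<open>E n\<close>, which eventually vanishes at each pair.\<close>
  define h where "h x = - H (K x) x" for x
  have h: "h x = - H n x" if "K x \<le> n" for n x
  proof -
    have "H n x = H (K x) x"
      unfolding H_def using that by (intro sum.mono_neutral_right) (auto intro!: t_zero K)
    then show ?thesis by (simp add: h_def)
  qed
  show ?thesis
  proof
    have "(\<lambda>x. H (K x) x) \<in> measurable borel (count_space UNIV)"
    \<comment> \<open>On each of the countably many level sets of \<open>K\<close> the map agrees
      with a fixed Borel \<open>H n\<close>.\<close>
    proof (rule measurable_compose_countable[where f = H])
      show "H n \<in> measurable borel (count_space UNIV)" for n
        using H by (simp add: borel_map_def)
      show "K \<in> measurable borel (count_space UNIV)" unfolding K_def by measurable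
    qed
    then show "borel_map h" unfolding borel_map_def h_def by measurable
    fix x y :: 'a
    \<comment> \<open>One level late enough for all three points.\<close>
    define n where "n = Max {K x, K y, K (x + y)}"
    have n: "K x \<le> n" "K y \<le> n" "K (x + y) \<le> n" by (auto simp: n_def)
    then have "E n (x, y) = 0" by (intro E_zero K)
    then show "D (x, y) = h x + h y - h (x + y)"
      using E_eq[of n x y] h[OF n(1)] h[OF n(2)] h[OF n(3)] by (simp add: algebra_simps)
  qed
qed

text \<open>Subtracting the coboundary of the local solution \<open>s\<close> leaves a cocycle that
  vanishes near the origin, hence the coboundary of some \<open>k\<close>; then \<open>s + k\<close>
  serves for \<open>C\<close>.\<close>

theorem borel_cocycle_is_coboundary:
  fixes C :: "'a::euclidean_space \<times> 'a \<Rightarrow> 'g::{ab_group_add, countable}"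
  assumes C: "abelian_cocycle C" and borel: "borel_map C"
  obtains h where "borel_map h" "\<And>x y. C (x, y) = h x + h y - h (x + y)"
proof -
  obtain s d where s: "borel_map s" and d: "d > 0"
    and C_eq: "\<And>x y. norm x < d \<Longrightarrow> norm y < d \<Longrightarrow> norm (x + y) < d \<Longrightarrow> C (x, y) = s x + s y - s (x + y)"
    using borel_cocycle_locally_coboundary[OF C borel] by blast
  have s0: "s 0 = 0" using C_eq[of 0 0] d C by (simp add: abelian_cocycle_def)
  define D where "D u = C u + - coboundary_of s u" for u
  have "abelian_cocycle D"
    unfolding D_def using C abelian_cocycle_coboundary_of[where h = s] s0
    by (intro abelian_cocycle_add abelian_cocycle_uminus)
  moreover have "borel_map D"
    unfolding D_def by (rule borel_map_binop[OF borel borel_map_coboundary_of[OF s], of "\<lambda>c b. c + - b"])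
  moreover have "D (x, y) = 0" if "norm x < d" "norm y < d" "norm (x + y) < d" for x y
    using C_eq[OF that] by (simp add: D_def coboundary_of_def)
  ultimately obtain k where k: "borel_map k" "\<And>x y. D (x, y) = k x + k y - k (x + y)"
    using locally_zero_cocycle_coboundary[of D d] d by blast
  show ?thesis
  proof
    show "borel_map (\<lambda>x. s x + k x)" by (rule borel_map_binop[OF s k(1)])
    show "C (x, y) = s x + k x + (s y + k y) - (s (x + y) + k (x + y))" for x y
    proof -
      have "C (x, y) = D (x, y) + (s x + s y - s (x + y))"
        by (simp add: D_def coboundary_of_def)
      then show ?thesis by (simp add: k(2) algebra_simps)
    qed
  qed
qed

section \<open>The cohomology group and abelian extensions\<close>

lemma group_borel_cocycle_group:
  "group (borel_cocycle_group :: ('a::{topological_space, ab_group_add} \<times> 'a \<Rightarrow> 'g::{ab_group_add,countable}) monoid)"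
proof (rule groupI)
  fix C :: "'a \<times> 'a \<Rightarrow> 'g" assume "C \<in> carrier borel_cocycle_group"
  then have C: "abelian_cocycle C" "borel_map C"
    by (auto simp: borel_cocycle_group_def borel_cocycles_def)
  have "(\<lambda>u. - C u) \<in> borel_cocycles"
    using abelian_cocycle_uminus[OF C(1)] borel_map_binop[OF C(2) C(2), of "\<lambda>c _. - c"]
    by (simp add: borel_cocycles_def)
  then show "\<exists>D\<in>carrier borel_cocycle_group. D \<otimes>\<^bsub>borel_cocycle_group\<^esub> C = \<one>\<^bsub>borel_cocycle_group\<^esub>"
    by (intro bexI[of _ "\<lambda>u. - C u"]) (auto simp: borel_cocycle_group_def)
qed (auto simp: borel_cocycle_group_def borel_cocycles_def abelian_cocycle_add abelian_cocycle_zero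
    borel_map_binop add.assoc, simp add: borel_map_def)

lemma trivial_factor_group:
  assumes "group G" "N = carrier G"
  shows "trivial_group (G Mod N)"
proof -
  interpret group G by fact
  have "N \<lhd> G" unfolding assms(2) by (rule normal_self)
  then have "group (G Mod N)" by (rule normal.factorgroup_is_group)
  moreover have "carrier (G Mod N) = {N}"
    unfolding carrier_FactGroup assms(2) using coset_join2[OF _ subgroup_self] one_closed by auto
  ultimately show ?thesis by (simp add: trivial_group_def)
qed

text \<open>One inclusion is the main result; the other needs that \<open>coboundary_of h\<close>
  inherits Borel measurability from \<open>h\<close>.\<close>

lemma borel_coboundaries_eq_cocycles:
  "(borel_coboundaries :: ('a::euclidean_space \<times> 'a \<Rightarrow> 'g::{ab_group_add, countable}) set) = borel_cocycles"
proof (intro equalityI subsetI)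
  fix C :: "'a \<times> 'a \<Rightarrow> 'g"
  assume "C \<in> borel_coboundaries"
  then obtain h where C: "abelian_cocycle C" "C = coboundary_of h" and h: "borel_map h"
    by (auto simp: borel_coboundaries_def)
  with C borel_map_coboundary_of[OF h] show "C \<in> borel_cocycles" by (simp add: borel_cocycles_def)
next
  fix C :: "'a \<times> 'a \<Rightarrow> 'g"
  assume "C \<in> borel_cocycles"
  then have C: "abelian_cocycle C" "borel_map C" by (auto simp: borel_cocycles_def)
  then obtain h where "borel_map h" "\<And>x y. C (x, y) = h x + h y - h (x + y)"
    using borel_cocycle_is_coboundary by blast
  then have "borel_map h \<and> C = coboundary_of h" by (auto simp: coboundary_of_def)
  with C show "C \<in> borel_coboundaries" by (auto simp: borel_coboundaries_def)
qed

text \<open>The shear \<open>\<theta>\<close> is an isomorphism from the direct sum to the twisted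
  product over the same quotient; \<open>h 0 = 0\<close> makes it fix the copy of the coefficient
  group.\<close>

lemma induced_by_coboundary_imp_trivial_extension:
  fixes h :: "'a::ab_group_add \<Rightarrow> 'g::ab_group_add"
  assumes ext: "abelian_extension i p"
    and "induced_by_cocycle (coboundary_of h) i p" and h0: "h 0 = 0"
  shows "trivial_extension i p"
proof -
  obtain \<phi> where bij: "bij \<phi>"
    and add: "\<And>u v. \<phi> (cocycle_add (coboundary_of h) u v) = \<phi> u + \<phi> v"
    and \<phi>: "\<And>g. \<phi> (g, 0) = i g" "\<And>u. p (\<phi> u) = snd u"
    using assms by (auto simp: induced_by_cocycle_def)
  define \<theta> where "\<theta> = (\<lambda>(g, x). (g - h x, x))"
  have "bij \<theta>"
    by (rule bij_betw_byWitness[of _ "\<lambda>(g, x). (g + h x, x)"]) (auto simp: \<theta>_def)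
  then have "bij (\<phi> \<circ> \<theta>)" using bij by (rule bij_comp)
  moreover have "\<theta> (u + v) = cocycle_add (coboundary_of h) (\<theta> u) (\<theta> v)" for u v
    by (cases u; cases v) (simp add: \<theta>_def cocycle_add_def coboundary_of_def algebra_simps)
  then have "Modules.additive (\<phi> \<circ> \<theta>)"
    by unfold_locales (simp add: add)
  moreover have "(\<phi> \<circ> \<theta>) (g, 0) = i g" "p ((\<phi> \<circ> \<theta>) u) = snd u" for g u
    using \<phi> h0 by (auto simp: \<theta>_def split: prod.splits)
  ultimately show ?thesis using ext unfolding trivial_extension_def by blast
qed

text \<open>The zero cocycle induces the direct sum.\<close>

lemma trivial_extension_imp_borel_definable:
  assumes "trivial_extension i p"
  shows "borel_definable_extension i p"
proof -
  obtain \<phi> where ext: "abelian_extension i p" and "bij \<phi>" and add: "Modules.additive \<phi>"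
    and \<phi>: "\<forall>g. \<phi> (g, 0) = i g" "\<forall>u. p (\<phi> u) = snd u"
    using assms by (auto simp: trivial_extension_def)
  have "\<phi> (cocycle_add (\<lambda>_. 0) u v) = \<phi> u + \<phi> v" for u v
  proof -
    have "cocycle_add (\<lambda>_. 0) u v = u + v"
      by (cases u; cases v) (simp add: cocycle_add_def)
    then show ?thesis by (simp add: additive.add[OF add])
  qed
  with \<open>bij \<phi>\<close> \<phi> have "induced_by_cocycle (\<lambda>_. 0) i p"
    unfolding induced_by_cocycle_def by blast
  moreover have "(\<lambda>_. 0) \<in> borel_cocycles"
    by (simp add: borel_cocycles_def abelian_cocycle_zero borel_map_def)
  ultimately show ?thesis using ext unfolding borel_definable_extension_def by blast
qed

lemma borel_definable_extension_imp_trivial: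
  fixes p :: "'e::ab_group_add \<Rightarrow> 'a::euclidean_space"
    and i :: "'g::{ab_group_add, countable} \<Rightarrow> 'e"
  assumes "borel_definable_extension i p"
  shows "trivial_extension i p"
proof -
  obtain C where ext: "abelian_extension i p" and "C \<in> borel_cocycles" and ind: "induced_by_cocycle C i p"
    using assms by (auto simp: borel_definable_extension_def)
  then have "C \<in> borel_coboundaries" by (simp add: borel_coboundaries_eq_cocycles)
  then obtain h where C: "abelian_cocycle C" "C = coboundary_of h"
    by (auto simp: borel_coboundaries_def)
  \<comment> \<open>The normalisation of \<open>C\<close> at the origin supplies
    \<open>h 0 = 0\<close> for the shear.\<close>
  then have "C (0, 0) = 0" "C (0, 0) = h 0" by (auto simp: abelian_cocycle_def coboundary_of_def)
  then show ?thesis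
    using induced_by_coboundary_imp_trivial_extension[OF ext] ind C by simp
qed

text \<open>The dimension \<open>N\<close> is the cardinality of the finite type \<open>'n\<close>,
  at least 1 because types are nonempty.\<close>

theorem theorem4p6:
  "trivial_group
     (H2_Bor :: ((real ^ 'n) \<times> (real ^ 'n) \<Rightarrow> 'g::{ab_group_add, countable}) set monoid) \<and>
   (\<forall>C :: (real ^ 'n) \<times> (real ^ 'n) \<Rightarrow> 'g. abelian_cocycle C \<and> borel_map C \<longrightarrow>
     (\<exists>h :: real ^ 'n \<Rightarrow> 'g. borel_map h \<and> (\<forall>x y. C (x, y) = h x + h y - h (x + y)))) \<and>
   (\<forall>(i :: 'g \<Rightarrow> 'e::ab_group_add) (p :: 'e \<Rightarrow> real ^ 'n).
     borel_definable_extension i p \<longleftrightarrow> trivial_extension i p)"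
proof (intro conjI allI impI)
  show "trivial_group
     (H2_Bor :: ((real ^ 'n) \<times> (real ^ 'n) \<Rightarrow> 'g::{ab_group_add, countable}) set monoid)"
    unfolding H2_Bor_def
    by (rule trivial_factor_group[OF group_borel_cocycle_group])
      (simp add: borel_coboundaries_eq_cocycles borel_cocycle_group_def)
next
  fix C :: "(real ^ 'n) \<times> (real ^ 'n) \<Rightarrow> 'g"
  assume "abelian_cocycle C \<and> borel_map C"
  then show "\<exists>h :: real ^ 'n \<Rightarrow> 'g. borel_map h \<and> (\<forall>x y. C (x, y) = h x + h y - h (x + y))"
    using borel_cocycle_is_coboundary by blast
next
  fix i :: "'g \<Rightarrow> 'e::ab_group_add" and p :: "'e \<Rightarrow> real ^ 'n"
  show "borel_definable_extension i p \<longleftrightarrow> trivial_extension i p"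
    using borel_definable_extension_imp_trivial trivial_extension_imp_borel_definable by blast
qed

end
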